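(* Let $\mathbb{K}$ be a field, let $i\in\{1,\dots,6\}$, and let $\mathcal{P}=G_i\text{-}\mathcal{A}ss$ be the quadratic operad attached to the subgroup $G_i$ of $\Sigma_3$. Let $\mathcal{P}^!$ be its quadratic dual operad and $\tilde{\mathcal{P}}$ the associated operad computed from the presentation $v_1=w_1=V_i=\sum_{\sigma\in G_i}\mathrm{sgn}(\sigma)\,\sigma$ of $\mathcal{P}$ (all as defined in the context). Then $\mathcal{P}^!=\tilde{\mathcal{P}}$; that is, their modules of relations in $\Gamma(E)(3)$ coincide.
   Context: Let $E=\mathbb{K}[\Sigma_2]$ (one operation with no symmetry) and let $\Gamma(E)$ be the free operad on $E$ placed in arity 2. $\Gamma(E)(3)$ is the 12-dimensional $\mathbb{K}$-vector space with basis $x_i\cdot(x_j\cdot x_k)$, $(x_i\cdot x_j)\cdot x_k$, $\{i,j,k\}=\{1,2,3\}$. $\Sigma_3$ acts by $\sigma(x_i\cdot(x_j\cdot x_k))=x_{\sigma^{-1}(i)}\cdot(x_{\sigma^{-1}(j)}\cdot x_{\sigma^{-1}(k)})$ and $\sigma((x_i\cdot x_j)\cdot x_k)=(x_{\sigma^{-1}(i)}\cdot x_{\sigma^{-1}(j)})\cdot x_{\sigma^{-1}(k)}$. A quadratic operad generated by $E$ is $\Gamma(E)/(R)$ with $R\subset\Gamma(E)(3)$ a $\Sigma_3$-invariant subspace, its module of relations. The subgroups of $\Sigma_3$ are $G_1=\{Id\}$, $G_2=\langle(1\,2)\rangle$, $G_3=\langle(2\,3)\rangle$, $G_4=\langle(1\,3)\rangle$,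 $G_5=\langle(1\,2\,3)\rangle$, $G_6=\Sigma_3$. Let $X=x_1\cdot(x_2\cdot x_3)-(x_1\cdot x_2)\cdot x_3$ and $X_i=\sum_{\sigma\in G_i}\mathrm{sgn}(\sigma)\,\sigma(X)$. Let $R_i$ be the span of the $\Sigma_3$-orbit of $X_i$. Then $G_i\text{-}\mathcal{A}ss=\Gamma(E)/(R_i)$. Dual operad: $(G_i\text{-}\mathcal{A}ss)^!$ is the quadratic operad generated by $E$ whose module of relations is the orthogonal of $R_i$ in $\Gamma(E)(3)$ for the symmetric bilinear form for which distinct basis vectors are orthogonal and $$\langle x_i\cdot(x_j\cdot x_k),x_i\cdot(x_j\cdot x_k)\rangle=\mathrm{sgn}\begin{pmatrix}1&2&3\\ i&j&k\end{pmatrix},\qquad \langle (x_i\cdot x_j)\cdot x_k,(x_i\cdot x_j)\cdot x_k\rangle=-\mathrm{sgn}\begin{pmatrix}1&2&3\\ i&j&k\end{pmatrix}.$$ The operad $\tilde{\mathcal{P}}$: write $\Sigma_3=\{\sigma_1,\dots,\sigma_6\}$. In general, for $\mathcal{P}=\Gamma(E)/(R)$ with $R$ generated as a $\Sigma_3$-invariant subspace by one vector $\sum_l a_l\,\sigma_l((x_1\cdot x_2)\cdot x_3)-\sum_l b_l\,\sigma_l(x_1\cdot(x_2\cdot x_3))$, with $v_1=\sum_l a_l\sigma_l$ and $w_1=\sum_l b_l\sigma_l$, the operad $\tilde{\mathcal{P}}$ is $\Gamma(E)/(\tilde R)$, where $\tilde R$ is the $\Sigma_3$-invariant subspace of $\Gamma(E)(3)$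 generated by, for all $1\le l,m\le 6$, $$a_l a_m\big(\sigma_l((x_1\cdot x_2)\cdot x_3)-\sigma_m((x_1\cdot x_2)\cdot x_3)\big),$$ $$b_l b_m\big(\sigma_l(x_1\cdot(x_2\cdot x_3))-\sigma_m(x_1\cdot(x_2\cdot x_3))\big),$$ $$a_l b_m\big(\sigma_l((x_1\cdot x_2)\cdot x_3)-\sigma_m(x_1\cdot(x_2\cdot x_3))\big).$$ For $G_i\text{-}\mathcal{A}ss$ the presentation used is $v_1=w_1=V_i=\sum_{\sigma\in G_i}\mathrm{sgn}(\sigma)\,\sigma$. *)

theory Defs
  imports Complex_Main "HOL-Algebra.Sym_Groups" "HOL-Library.Poly_Mapping"
begin

section \<open>The free operad on one binary operation without symmetry\<close>

datatype 'a mag = Var 'a | Prod "'a mag" "'a mag" (infix \<open>\<star>\<close> 70)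

primrec bind_mag :: "'a mag \<Rightarrow> ('a \<Rightarrow> 'b mag) \<Rightarrow> 'b mag" where
  "bind_mag (Var a) h = h a"
| "bind_mag (s \<star> t) h = bind_mag s h \<star> bind_mag t h"

primrec vars :: "'a mag \<Rightarrow> 'a list" where
  "vars (Var a) = [a]"
| "vars (s \<star> t) = vars s @ vars t"

text \<open>
  Since \<open>E\<close> is the regular representation of the symmetric group on two letters, the trees
  whose leaves are labelled bijectively by \<open>1, \<dots>, n\<close> form a basis of \<open>\<Gamma>(E)(n)\<close>.
  Elements of all \<open>\<Gamma>(E)(n)\<close> live in the one type of formal linear combinations of trees.
\<close>

definition monomials :: "nat \<Rightarrow> nat mag set" where
  "monomials n = {t. distinct (vars t) \<and> set (vars t) = {1..n}}"

definition Gamma :: "nat \<Rightarrow> (nat mag \<Rightarrow>\<^sub>0 'k::field) set" where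
  "Gamma n = {f. Poly_Mapping.keys f \<subseteq> monomials n}"

abbreviation basis :: "nat mag \<Rightarrow> (nat mag \<Rightarrow>\<^sub>0 'k::field)" where
  "basis t \<equiv> Poly_Mapping.single t 1"

definition scale :: "'k \<Rightarrow> ('a \<Rightarrow>\<^sub>0 'k) \<Rightarrow> ('a \<Rightarrow>\<^sub>0 'k::field)" where
  "scale c f = Poly_Mapping.map (\<lambda>x. c * x) f"

lemma lookup_scale [simp]: "Poly_Mapping.lookup (scale c f) t = c * Poly_Mapping.lookup f t"
  by (simp add: scale_def Poly_Mapping.map.rep_eq when_def)

interpretation lin: vector_space "scale :: 'k::field \<Rightarrow> ('a \<Rightarrow>\<^sub>0 'k) \<Rightarrow> ('a \<Rightarrow>\<^sub>0 'k)"
  by unfold_locales (auto intro!: poly_mapping_eqI simp: lookup_add algebra_simps)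

text \<open>
  A permutation replaces every \<open>x\<^sub>i\<close> by \<open>x\<^sub>j\<close> with \<open>j = \<sigma>\<inverse>(i)\<close>; this is the right action of the
  symmetric groups on an operad, whence \<open>act \<sigma> (act \<tau> f) = act (\<tau> \<circ> \<sigma>) f\<close>.
\<close>

definition act :: "(nat \<Rightarrow> nat) \<Rightarrow> (nat mag \<Rightarrow>\<^sub>0 'k) \<Rightarrow> (nat mag \<Rightarrow>\<^sub>0 'k::field)" where
  "act \<sigma> f = (\<Sum>t\<in>Poly_Mapping.keys f.
     Poly_Mapping.single (map_mag (Hilbert_Choice.inv \<sigma>) t) (Poly_Mapping.lookup f t))"

lemma act_add: "act \<sigma> (f + g) = act \<sigma> f + act \<sigma> g"
  unfolding act_def by (rule Poly_Mapping.poly_mapping_eqI, subst Poly_Mapping.setsum_keys_plus_distrib)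
   (auto simp: single_add)

lemma act_scale: "act \<sigma> (scale c f) = scale c (act \<sigma> f)"
proof -
  have "act \<sigma> (scale c f) = (\<Sum>t\<in>Poly_Mapping.keys f.
     Poly_Mapping.single (map_mag (Hilbert_Choice.inv \<sigma>) t) (c * Poly_Mapping.lookup f t))"
    unfolding act_def lookup_scale
    by (rule sum.mono_neutral_left) (auto simp: in_keys_iff)
  also have "\<dots> = scale c (act \<sigma> f)"
    unfolding act_def lin.scale_sum_right
    by (rule sum.cong) (auto intro!: poly_mapping_eqI simp: lookup_single when_def)
  finally show ?thesis .
qed

lemma act_zero: "act \<sigma> 0 = 0"
  by (simp add: act_def)

lemma act_sum: "act \<sigma> (sum h A) = (\<Sum>x\<in>A. act \<sigma> (h x))"
  by (induction A rule: infinite_finite_induct) (simp_all add: act_add act_zero)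

lemma act_single:
  "act \<sigma> (Poly_Mapping.single t c) = Poly_Mapping.single (map_mag (Hilbert_Choice.inv \<sigma>) t) c"
  by (auto simp: act_def)

lemma act_comp:
  assumes "bij \<sigma>" "bij \<tau>"
  shows "act \<sigma> (act \<tau> f) = act (\<tau> \<circ> \<sigma>) f"
  unfolding act_def[of \<tau> f] act_def[of "\<tau> \<circ> \<sigma>" f] act_sum act_single
  by (simp add: mag.map_comp o_inv_distrib assms)

text \<open>
  Partial composition \<open>f \<circ>\<^sub>i g\<close> for \<open>g\<close> of arity \<open>n\<close>: graft \<open>g\<close>, with its labels raised by
  \<open>i - 1\<close>, at the leaf \<open>i\<close> of \<open>f\<close>, and raise the labels of \<open>f\<close> beyond \<open>i\<close> by \<open>n - 1\<close>.
\<close>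

definition graft :: "nat \<Rightarrow> nat \<Rightarrow> nat mag \<Rightarrow> nat mag \<Rightarrow> nat mag" where
  "graft n i t s = bind_mag t (\<lambda>j.
     if j < i then Var j
     else if j = i then map_mag (\<lambda>l. l + i - 1) s
     else Var (j + n - 1))"

definition pcomp ::
  "nat \<Rightarrow> nat \<Rightarrow> (nat mag \<Rightarrow>\<^sub>0 'k) \<Rightarrow> (nat mag \<Rightarrow>\<^sub>0 'k) \<Rightarrow> (nat mag \<Rightarrow>\<^sub>0 'k::field)" where
  "pcomp n i f g = (\<Sum>t\<in>Poly_Mapping.keys f. \<Sum>s\<in>Poly_Mapping.keys g.
     Poly_Mapping.single (graft n i t s) (Poly_Mapping.lookup f t * Poly_Mapping.lookup g s))"


section \<open>Quadratic operads\<close>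

record ('k, 'a) operad =
  op_carrier :: "nat \<Rightarrow> 'a set"
  op_zero :: "nat \<Rightarrow> 'a"
  op_plus :: "nat \<Rightarrow> 'a \<Rightarrow> 'a \<Rightarrow> 'a"
  op_scale :: "nat \<Rightarrow> 'k \<Rightarrow> 'a \<Rightarrow> 'a"
  op_act :: "nat \<Rightarrow> (nat \<Rightarrow> nat) \<Rightarrow> 'a \<Rightarrow> 'a"
  op_unit :: 'a
  op_comp :: "nat \<Rightarrow> nat \<Rightarrow> nat \<Rightarrow> 'a \<Rightarrow> 'a \<Rightarrow> 'a"

text \<open>\<open>op_ideal R n\<close> is the arity \<open>n\<close> part of the operadic ideal \<open>(R)\<close> generated by
  \<open>R \<subseteq> \<Gamma>(E)(3)\<close>.\<close>

inductive op_ideal :: "(nat mag \<Rightarrow>\<^sub>0 'k::field) set \<Rightarrow> nat \<Rightarrow> (nat mag \<Rightarrow>\<^sub>0 'k) \<Rightarrow> bool"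
  for R where
  gen: "r \<in> R \<Longrightarrow> op_ideal R 3 r"
| zero: "op_ideal R n 0"
| add: "op_ideal R n f \<Longrightarrow> op_ideal R n g \<Longrightarrow> op_ideal R n (f + g)"
| scale: "op_ideal R n f \<Longrightarrow> op_ideal R n (scale c f)"
| act: "op_ideal R n f \<Longrightarrow> \<sigma> permutes {1..n} \<Longrightarrow> op_ideal R n (act \<sigma> f)"
| comp_left: "op_ideal R m f \<Longrightarrow> g \<in> Gamma n \<Longrightarrow> i \<in> {1..m} \<Longrightarrow>
    op_ideal R (m + n - 1) (pcomp n i f g)"
| comp_right: "f \<in> Gamma m \<Longrightarrow> op_ideal R n g \<Longrightarrow> i \<in> {1..m} \<Longrightarrow>
    op_ideal R (m + n - 1) (pcomp n i f g)"

definition ideal_class ::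
  "(nat mag \<Rightarrow>\<^sub>0 'k::field) set \<Rightarrow> nat \<Rightarrow> (nat mag \<Rightarrow>\<^sub>0 'k) \<Rightarrow> (nat mag \<Rightarrow>\<^sub>0 'k) set" where
  "ideal_class R n f = {g \<in> Gamma n. op_ideal R n (g - f)}"

text \<open>The quotient \<open>\<Gamma>(E)/(R)\<close>; as \<open>(R)\<close> is an ideal, each union below is over equal classes.\<close>

definition quadratic_operad ::
  "(nat mag \<Rightarrow>\<^sub>0 'k::field) set \<Rightarrow> ('k, (nat mag \<Rightarrow>\<^sub>0 'k) set) operad" where
  "quadratic_operad R =
    \<lparr> op_carrier = (\<lambda>n. ideal_class R n ` Gamma n),
      op_zero = (\<lambda>n. ideal_class R n 0),
      op_plus = (\<lambda>n A B. \<Union>a\<in>A. \<Union>b\<in>B. ideal_class R n (a + b)),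
      op_scale = (\<lambda>n c A. \<Union>a\<in>A. ideal_class R n (scale c a)),
      op_act = (\<lambda>n \<sigma> A. \<Union>a\<in>A. ideal_class R n (act \<sigma> a)),
      op_unit = ideal_class R 1 (basis (Var 1)),
      op_comp = (\<lambda>m n i A B. \<Union>a\<in>A. \<Union>b\<in>B. ideal_class R (m + n - 1) (pcomp n i a b)) \<rparr>"


section \<open>Arity three\<close>

abbreviation Sigma3 :: "(nat \<Rightarrow> nat) set" where
  "Sigma3 \<equiv> carrier (sym_group 3)"

definition right_mon :: "nat \<Rightarrow> nat \<Rightarrow> nat \<Rightarrow> nat mag" where
  "right_mon i j k = Var i \<star> (Var j \<star> Var k)"

definition left_mon :: "nat \<Rightarrow> nat \<Rightarrow> nat \<Rightarrow> nat mag" where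
  "left_mon i j k = (Var i \<star> Var j) \<star> Var k"

lemma vars_ne: "vars t \<noteq> []" by (induction t) auto
lemma vars1: "length (vars t) = 1 \<longleftrightarrow> (\<exists>a. t = Var a)"
  by (cases t) (auto simp: vars_ne add_is_1)
lemma vars2: "length (vars t) = 2 \<longleftrightarrow> (\<exists>a b. t = Var a \<star> Var b)"
proof (cases t)
  case (Prod s u)
  have "length (vars s) \<ge> 1" "length (vars u) \<ge> 1" by (simp_all add: Suc_le_eq vars_ne)
  then have "length (vars t) = 2 \<longleftrightarrow> length (vars s) = 1 \<and> length (vars u) = 1" using Prod by auto
  then show ?thesis using Prod vars1 by auto
qed auto
lemma vars3: "length (vars t) = 3 \<longleftrightarrow> (\<exists>a b c. t = right_mon a b c \<or> t = left_mon a b c)"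
proof (cases t)
  case (Prod s u)
  have "length (vars s) \<ge> 1" "length (vars u) \<ge> 1" by (simp_all add: Suc_le_eq vars_ne)
  then have "length (vars t) = 3 \<longleftrightarrow> length (vars s) = 1 \<and> length (vars u) = 2 \<or> length (vars s) = 2 \<and> length (vars u) = 1" using Prod by auto
  then show ?thesis using Prod vars1 vars2 by (auto simp: right_mon_def left_mon_def)
qed (auto simp: right_mon_def left_mon_def)

lemma monomials3:
  "monomials 3 = {right_mon i j k | i j k. {i, j, k} = {1, 2, 3}}
               \<union> {left_mon i j k | i j k. {i, j, k} = {1, 2, 3}}"
proof -
  have s: "{1..3} = {1, 2, 3::nat}" by auto
  have d: "distinct [i, j, k]" if "{i, j, k} = {1, 2, 3}" for i j k :: nat
  proof (rule card_distinct)
    have "card (set [i, j, k]) = card {1, 2, 3::nat}" using that by simp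
    then show "card (set [i, j, k]) = length [i, j, k]" by simp
  qed
  have l: "length (vars t) = 3" if "t \<in> monomials 3" for t
    using that distinct_card[of "vars t"] by (simp add: monomials_def)
  show ?thesis (is "_ = ?M")
  proof (intro equalityI subsetI)
    fix t assume t: "t \<in> monomials 3"
    then obtain a b c where "t = right_mon a b c \<or> t = left_mon a b c"
      using l vars3 by blast
    moreover from this t have "{a, b, c} = {1, 2, 3}"
      unfolding monomials_def s right_mon_def left_mon_def by (elim disjE) simp_all
    ultimately show "t \<in> ?M" by blast
  next
    fix t assume "t \<in> ?M"
    then obtain i j k where ijk: "{i, j, k} = {1, 2, 3}"
      and t: "t = right_mon i j k \<or> t = left_mon i j k" by blast
    from t have "vars t = [i, j, k]" by (auto simp: right_mon_def left_mon_def)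
    then show "t \<in> monomials 3"
      using d[OF ijk] ijk unfolding monomials_def s by simp
  qed
qed

definition invariant :: "(nat mag \<Rightarrow>\<^sub>0 'k::field) set \<Rightarrow> bool" where
  "invariant W \<longleftrightarrow> lin.subspace W \<and> (\<forall>\<sigma>\<in>Sigma3. \<forall>f\<in>W. act \<sigma> f \<in> W)"

text \<open>The permutation with two-line notation \<open>(1 2 3; i j k)\<close> is the \<open>\<sigma>\<close> with
  \<open>\<sigma> 1 = i\<close>, \<open>\<sigma> 2 = j\<close>, \<open>\<sigma> 3 = k\<close>.\<close>

definition form :: "(nat mag \<Rightarrow>\<^sub>0 'k) \<Rightarrow> (nat mag \<Rightarrow>\<^sub>0 'k) \<Rightarrow> 'k::field" where
  "form f g = (\<Sum>\<sigma>\<in>Sigma3. of_int (sign \<sigma>) *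
     (let r = right_mon (\<sigma> 1) (\<sigma> 2) (\<sigma> 3); l = left_mon (\<sigma> 1) (\<sigma> 2) (\<sigma> 3) in
      Poly_Mapping.lookup f r * Poly_Mapping.lookup g r
      - Poly_Mapping.lookup f l * Poly_Mapping.lookup g l))"

definition dual_relations :: "(nat mag \<Rightarrow>\<^sub>0 'k::field) set \<Rightarrow> (nat mag \<Rightarrow>\<^sub>0 'k) set" where
  "dual_relations R = {f \<in> Gamma 3. \<forall>g\<in>R. form f g = 0}"

lemma Sigma3_iff: "\<sigma> \<in> Sigma3 \<longleftrightarrow> \<sigma> permutes {1..3}"
  by (simp add: sym_group_def)

lemma fin3: "finite Sigma3" by (simp add: sym_group_def finite_permutations)

lemma perm3_eq:
  assumes "\<sigma> \<in> Sigma3" "\<tau> \<in> Sigma3" "\<tau> 1 = \<sigma> 1" "\<tau> 2 = \<sigma> 2" "\<tau> 3 = \<sigma> 3" shows "\<tau> = \<sigma>"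
proof
  fix x show "\<tau> x = \<sigma> x"
  proof (cases "x \<in> {1..3}")
    case True then have "x = 1 \<or> x = 2 \<or> x = 3" by auto
    then show ?thesis using assms by auto
  next
    case False then show ?thesis using assms unfolding Sigma3_iff permutes_def by simp
  qed
qed

lemma form_rr: assumes "\<sigma> \<in> Sigma3" "\<tau> \<in> Sigma3"
  shows "form (basis (right_mon (\<sigma> 1) (\<sigma> 2) (\<sigma> 3))) (basis (right_mon (\<tau> 1) (\<tau> 2) (\<tau> 3)))
    = (if \<sigma> = \<tau> then of_int (sign \<sigma>) else (0::'k::field))"
proof -
  have "form (basis (right_mon (\<sigma> 1) (\<sigma> 2) (\<sigma> 3))) (basis (right_mon (\<tau> 1) (\<tau> 2) (\<tau> 3)) :: nat mag \<Rightarrow>\<^sub>0 'k)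
    = (\<Sum>\<rho>\<in>Sigma3. if \<rho> = \<sigma> then (if \<sigma> = \<tau> then of_int (sign \<sigma>) else 0) else 0)"
    unfolding form_def
    by (rule sum.cong[OF refl]) (auto simp: Let_def lookup_single right_mon_def left_mon_def when_def dest: perm3_eq[OF assms(1)] perm3_eq[OF assms(2)] perm3_eq)
  then show ?thesis using assms by (simp add: fin3)
qed

lemma form_ll: assumes "\<sigma> \<in> Sigma3" "\<tau> \<in> Sigma3"
  shows "form (basis (left_mon (\<sigma> 1) (\<sigma> 2) (\<sigma> 3))) (basis (left_mon (\<tau> 1) (\<tau> 2) (\<tau> 3)))
    = (if \<sigma> = \<tau> then - of_int (sign \<sigma>) else (0::'k::field))"
proof -
  have "form (basis (left_mon (\<sigma> 1) (\<sigma> 2) (\<sigma> 3))) (basis (left_mon (\<tau> 1) (\<tau> 2) (\<tau> 3)) :: nat mag \<Rightarrow>\<^sub>0 'k)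
    = (\<Sum>\<rho>\<in>Sigma3. if \<rho> = \<sigma> then (if \<sigma> = \<tau> then - of_int (sign \<sigma>) else 0) else 0)"
    unfolding form_def
    by (rule sum.cong[OF refl]) (auto simp: Let_def lookup_single right_mon_def left_mon_def when_def dest: perm3_eq[OF assms(1)] perm3_eq[OF assms(2)] perm3_eq)
  then show ?thesis using assms by (simp add: fin3)
qed

lemma form_distinct: "s \<noteq> t \<Longrightarrow> form (basis s) (basis t) = (0::'k::field)"
  unfolding form_def by (rule sum.neutral) (auto simp: Let_def lookup_single when_def)

text \<open>The vectors \<open>v = \<Sum> a\<^sub>l \<sigma>\<^sub>l\<close> and \<open>w = \<Sum> b\<^sub>l \<sigma>\<^sub>l\<close> of the group algebra are encoded by
  their coefficient functions; indices \<open>l, m\<close> become the permutations \<open>\<sigma>, \<tau>\<close> themselves.\<close>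

type_synonym 'k group_alg = "(nat \<Rightarrow> nat) \<Rightarrow>\<^sub>0 'k"

definition presenting_vector ::
  "'k group_alg \<Rightarrow> 'k group_alg \<Rightarrow> (nat mag \<Rightarrow>\<^sub>0 'k::field)" where
  "presenting_vector v w =
     (\<Sum>\<sigma>\<in>Sigma3. scale (Poly_Mapping.lookup v \<sigma>) (act \<sigma> (basis (left_mon 1 2 3))))
     - (\<Sum>\<sigma>\<in>Sigma3. scale (Poly_Mapping.lookup w \<sigma>) (act \<sigma> (basis (right_mon 1 2 3))))"

definition tilde_relations ::
  "'k group_alg \<Rightarrow> 'k group_alg \<Rightarrow> (nat mag \<Rightarrow>\<^sub>0 'k::field) set" where
  "tilde_relations v w =
    (let a = Poly_Mapping.lookup v; b = Poly_Mapping.lookup w;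
         L = (\<lambda>\<sigma>. act \<sigma> (basis (left_mon 1 2 3)));
         R = (\<lambda>\<sigma>. act \<sigma> (basis (right_mon 1 2 3)))
     in invariant hull
       ({scale (a \<sigma> * a \<tau>) (L \<sigma> - L \<tau>) | \<sigma> \<tau>. \<sigma> \<in> Sigma3 \<and> \<tau> \<in> Sigma3} \<union>
        {scale (b \<sigma> * b \<tau>) (R \<sigma> - R \<tau>) | \<sigma> \<tau>. \<sigma> \<in> Sigma3 \<and> \<tau> \<in> Sigma3} \<union>
        {scale (a \<sigma> * b \<tau>) (L \<sigma> - R \<tau>) | \<sigma> \<tau>. \<sigma> \<in> Sigma3 \<and> \<tau> \<in> Sigma3}))"


section \<open>The operads attached to the subgroups of the symmetric group\<close>

text \<open>Only the indices \<open>1, \<dots>, 6\<close> are meaningful.\<close>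

definition G :: "nat \<Rightarrow> (nat \<Rightarrow> nat) set" where
  "G i = (if i = 1 then {id}
     else if i = 2 then generate (sym_group 3) {transpose 1 2}
     else if i = 3 then generate (sym_group 3) {transpose 2 3}
     else if i = 4 then generate (sym_group 3) {transpose 1 3}
     else if i = 5 then generate (sym_group 3) {cycle_of_list [1, 2, 3]}
     else Sigma3)"

definition X_assoc :: "nat mag \<Rightarrow>\<^sub>0 'k::field" where
  "X_assoc = basis (right_mon 1 2 3) - basis (left_mon 1 2 3)"

definition X_G :: "nat \<Rightarrow> (nat mag \<Rightarrow>\<^sub>0 'k::field)" where
  "X_G i = (\<Sum>\<sigma>\<in>G i. scale (of_int (sign \<sigma>)) (act \<sigma> X_assoc))"

definition G_Ass_relations :: "nat \<Rightarrow> (nat mag \<Rightarrow>\<^sub>0 'k::field) set" where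
  "G_Ass_relations i = lin.span ((\<lambda>\<sigma>. act \<sigma> (X_G i)) ` Sigma3)"

definition V_G :: "nat \<Rightarrow> 'k::field group_alg" where
  "V_G i = (\<Sum>\<sigma>\<in>G i. Poly_Mapping.single \<sigma> (of_int (sign \<sigma>)))"

lemma G_subset: "G i \<subseteq> Sigma3"
proof -
  have gen: "generate (sym_group 3) {p} \<subseteq> Sigma3" if "p \<in> Sigma3" for p
    using group.generate_incl[OF sym_group_is_group, of "{p}" 3] that by auto
  have "transpose a b \<in> Sigma3" if "{a, b} \<subseteq> {1..3}" for a b
    using that permutes_swap_id[of a "{1..3}" b] unfolding Sigma3_iff by auto
  moreover have "cycle_of_list [1, 2, 3] \<in> Sigma3"
  proof -
    have "{1..3} = set [1, 2, 3::nat]" by auto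
    then show ?thesis unfolding Sigma3_iff by (metis cycle_permutes)
  qed
  moreover have "id \<in> Sigma3" by (simp add: Sigma3_iff permutes_id)
  ultimately show ?thesis using gen by (simp add: G_def)
qed

lemma presentation_vec: assumes "G i \<subseteq> Sigma3"
  shows "presenting_vector (V_G i) (V_G i) = - (X_G i :: nat mag \<Rightarrow>\<^sub>0 'k::field)"
proof -
  have f: "finite (G i)" using assms fin3 finite_subset by blast
  have l: "Poly_Mapping.lookup (V_G i :: 'k group_alg) \<sigma> = (if \<sigma> \<in> G i then of_int (sign \<sigma>) else 0)" for \<sigma>
    unfolding V_G_def lookup_sum using f by (auto simp: lookup_single when_def if_distrib cong: if_cong)
  have s: "(\<Sum>\<sigma>\<in>Sigma3. scale (Poly_Mapping.lookup (V_G i :: 'k group_alg) \<sigma>) (h \<sigma>)) = (\<Sum>\<sigma>\<in>G i. scale (of_int (sign \<sigma>)) (h \<sigma>))" for h :: "_ \<Rightarrow> nat mag \<Rightarrow>\<^sub>0 'k"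
    unfolding l by (rule sum.mono_neutral_cong_right[OF fin3 assms]) auto
  have "act \<sigma> (X_assoc :: nat mag \<Rightarrow>\<^sub>0 'k) = act \<sigma> (basis (right_mon 1 2 3)) - act \<sigma> (basis (left_mon 1 2 3))" for \<sigma>
  proof -
    have "act \<sigma> (X_assoc :: nat mag \<Rightarrow>\<^sub>0 'k) + act \<sigma> (basis (left_mon 1 2 3)) = act \<sigma> (X_assoc + basis (left_mon 1 2 3))"
      by (simp add: act_add)
    then show ?thesis by (simp add: X_assoc_def algebra_simps)
  qed
  then show ?thesis unfolding presenting_vector_def s X_G_def
    by (simp add: lin.scale_right_diff_distrib sum_subtractf)
qed

text \<open>The vectors \<open>v\<^sub>1 = w\<^sub>1 = V\<^sub>i\<close> do present \<open>G\<^sub>i-Ass\<close>.\<close>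

lemma G_Ass_presentation:
  "invariant hull {presenting_vector (V_G i) (V_G i)}
     = (G_Ass_relations i :: (nat mag \<Rightarrow>\<^sub>0 'k::field) set)"
proof (rule hull_unique)
  let ?X = "X_G i :: nat mag \<Rightarrow>\<^sub>0 'k"
  have bij: "bij \<sigma>" if "\<sigma> \<in> Sigma3" for \<sigma>
    using that permutes_bij unfolding Sigma3_iff by blast
  have "act id ?X = ?X"
  proof -
    have id: "id \<in> Sigma3" by (simp add: Sigma3_iff permutes_id)
    show ?thesis
      unfolding X_G_def act_sum act_scale
      by (rule sum.cong[OF refl]) (use G_subset bij id in \<open>auto simp: act_comp subset_iff\<close>)
  qed
  moreover have "id \<in> Sigma3" by (simp add: Sigma3_iff permutes_id)
  ultimately have "?X \<in> G_Ass_relations i"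
    unfolding G_Ass_relations_def by (metis imageI lin.span_base)
  then show "{presenting_vector (V_G i) (V_G i)} \<subseteq> (G_Ass_relations i :: (nat mag \<Rightarrow>\<^sub>0 'k) set)"
    unfolding presentation_vec[OF G_subset] G_Ass_relations_def by (simp add: lin.span_neg)
next
  let ?X = "X_G i :: nat mag \<Rightarrow>\<^sub>0 'k"
  let ?R = "G_Ass_relations i :: (nat mag \<Rightarrow>\<^sub>0 'k) set"
  have bij: "bij \<sigma>" if "\<sigma> \<in> Sigma3" for \<sigma>
    using that permutes_bij unfolding Sigma3_iff by blast
  have "act \<sigma> f \<in> ?R" if "\<sigma> \<in> Sigma3" "f \<in> ?R" for \<sigma> f
    using that(2) unfolding G_Ass_relations_def
  proof (induction rule: lin.span_induct_alt)
    case base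
    show ?case by (simp add: act_zero lin.span_zero)
  next
    case (step c x y)
    then obtain \<tau> where t: "\<tau> \<in> Sigma3" "x = act \<tau> ?X" by auto
    have "\<tau> \<circ> \<sigma> \<in> Sigma3" using t that(1) by (simp add: Sigma3_iff permutes_compose)
    then have "act \<sigma> x \<in> lin.span ((\<lambda>\<sigma>. act \<sigma> ?X) ` Sigma3)"
      using t that(1) bij by (simp add: act_comp lin.span_base)
    then show ?case using step.IH
      by (simp add: act_add act_scale lin.span_add lin.span_scale)
  qed
  then show "invariant ?R"
    by (simp add: invariant_def G_Ass_relations_def)
next
  fix W :: "(nat mag \<Rightarrow>\<^sub>0 'k) set"
  let ?X = "X_G i :: nat mag \<Rightarrow>\<^sub>0 'k"
  assume W: "{presenting_vector (V_G i) (V_G i)} \<subseteq> W" "invariant W"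
  then have "- ?X \<in> W" "lin.subspace W"
    unfolding presentation_vec[OF G_subset] invariant_def by auto
  then have "?X \<in> W"
    using lin.subspace_neg by fastforce
  then show "G_Ass_relations i \<subseteq> W"
    using W(2) unfolding G_Ass_relations_def invariant_def by (intro lin.span_minimal) auto
qed

definition G_Ass :: "nat \<Rightarrow> ('k::field, (nat mag \<Rightarrow>\<^sub>0 'k) set) operad" where
  "G_Ass i = quadratic_operad (G_Ass_relations i)"

definition G_Ass_dual :: "nat \<Rightarrow> ('k::field, (nat mag \<Rightarrow>\<^sub>0 'k) set) operad" where
  "G_Ass_dual i = quadratic_operad (dual_relations (G_Ass_relations i))"

definition G_Ass_tilde :: "nat \<Rightarrow> ('k::field, (nat mag \<Rightarrow>\<^sub>0 'k) set) operad" where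
  "G_Ass_tilde i = quadratic_operad (tilde_relations (V_G i) (V_G i))"

end

theory Submission
  imports Defs
begin

text \<open>
  Index the monomials by permutations: \<open>e\<^sub>\<sigma> = x\<^bsub>\<sigma> 1\<^esub>\<cdot>(x\<^bsub>\<sigma> 2\<^esub>\<cdot>x\<^bsub>\<sigma> 3\<^esub>)\<close> and
  \<open>f\<^sub>\<sigma> = (x\<^bsub>\<sigma> 1\<^esub>\<cdot>x\<^bsub>\<sigma> 2\<^esub>)\<cdot>x\<^bsub>\<sigma> 3\<^esub>\<close>. The orbit of \<open>X\<^sub>i\<close> consists of the
  vectors \<open>\<Sum>\<^bsub>g \<in> G\<^esub> sgn(g) (e\<^bsub>\<rho>g\<^esub> - f\<^bsub>\<rho>g\<^esub>)\<close>. Pairing one of them with \<open>h\<close>, the signs of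
  the form cancel those of the vector up to the global factor \<open>sgn(\<rho>)\<close>, so \<open>h\<close> lies in the
  orthogonal iff, on every coset \<open>\<rho>G\<close>, the coefficients of \<open>h\<close> at all \<open>e\<^bsub>\<rho>g\<^esub>\<close> and \<open>f\<^bsub>\<rho>g\<^esub>\<close>
  add up to zero. Such \<open>h\<close> are spanned by the differences of monomials belonging to the same
  coset, and these differences are the translates of the generators of the relations
  of \<open>\<P>\<tilde>\<close>, whose coefficients \<open>\<plusminus>1\<close> are invertible.
\<close>

section \<open>Permutations as labels of the monomials of arity three\<close>

abbreviation pinv :: "(nat \<Rightarrow> nat) \<Rightarrow> nat \<Rightarrow> nat" where
  "pinv \<equiv> Hilbert_Choice.inv"

definition rmon :: "(nat \<Rightarrow> nat) \<Rightarrow> nat mag" where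
  "rmon \<sigma> = right_mon (\<sigma> 1) (\<sigma> 2) (\<sigma> 3)"

definition lmon :: "(nat \<Rightarrow> nat) \<Rightarrow> nat mag" where
  "lmon \<sigma> = left_mon (\<sigma> 1) (\<sigma> 2) (\<sigma> 3)"

lemma Sigma3_id: "id \<in> Sigma3"
  and Sigma3_comp: "\<sigma> \<in> Sigma3 \<Longrightarrow> \<tau> \<in> Sigma3 \<Longrightarrow> \<sigma> \<circ> \<tau> \<in> Sigma3"
  and Sigma3_inv: "\<sigma> \<in> Sigma3 \<Longrightarrow> pinv \<sigma> \<in> Sigma3"
  and Sigma3_bij: "\<sigma> \<in> Sigma3 \<Longrightarrow> bij \<sigma>"
  and Sigma3_permutation: "\<sigma> \<in> Sigma3 \<Longrightarrow> permutation \<sigma>"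
  unfolding Sigma3_iff
  by (auto simp: permutes_id permutes_compose permutes_inv permutes_bij
      intro: permutes_imp_permutation)

lemma Sigma3_inv_comp: "\<sigma> \<in> Sigma3 \<Longrightarrow> pinv \<sigma> \<circ> (\<sigma> \<circ> \<tau>) = \<tau>"
  and Sigma3_comp_inv: "\<sigma> \<in> Sigma3 \<Longrightarrow> \<sigma> \<circ> (pinv \<sigma> \<circ> \<tau>) = \<tau>"
  and Sigma3_inv_inv: "\<sigma> \<in> Sigma3 \<Longrightarrow> pinv (pinv \<sigma>) = \<sigma>"
  and Sigma3_inv_id: "\<sigma> \<in> Sigma3 \<Longrightarrow> pinv \<sigma> \<circ> \<sigma> = id" "\<sigma> \<in> Sigma3 \<Longrightarrow> \<sigma> \<circ> pinv \<sigma> = id"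
  by (simp_all add: fun_eq_iff Sigma3_bij bij_is_inj bij_is_surj surj_f_inv_f inv_inv_eq)

lemma rmon_eq_iff: "\<sigma> \<in> Sigma3 \<Longrightarrow> \<tau> \<in> Sigma3 \<Longrightarrow> rmon \<sigma> = rmon \<tau> \<longleftrightarrow> \<sigma> = \<tau>"
  and lmon_eq_iff: "\<sigma> \<in> Sigma3 \<Longrightarrow> \<tau> \<in> Sigma3 \<Longrightarrow> lmon \<sigma> = lmon \<tau> \<longleftrightarrow> \<sigma> = \<tau>"
  and rmon_neq_lmon: "rmon \<sigma> \<noteq> lmon \<tau>" "lmon \<tau> \<noteq> rmon \<sigma>"
  by (auto simp: rmon_def lmon_def right_mon_def left_mon_def intro: perm3_eq)

lemma map_rmon: "map_mag \<sigma> (rmon \<tau>) = rmon (\<sigma> \<circ> \<tau>)"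
  and map_lmon: "map_mag \<sigma> (lmon \<tau>) = lmon (\<sigma> \<circ> \<tau>)"
  by (simp_all add: rmon_def lmon_def right_mon_def left_mon_def)

lemma act_rmon: "act \<sigma> (basis (rmon \<tau>)) = basis (rmon (pinv \<sigma> \<circ> \<tau>))"
  and act_lmon: "act \<sigma> (basis (lmon \<tau>)) = basis (lmon (pinv \<sigma> \<circ> \<tau>))"
  by (simp_all add: act_single map_rmon map_lmon)

lemma mon_id: "right_mon 1 2 3 = rmon id" "left_mon 1 2 3 = lmon id"
  by (simp_all add: rmon_def lmon_def)

lemma act_diff: "act \<sigma> (f - g) = act \<sigma> f - act \<sigma> g"
  using act_add[of \<sigma> "f - g" g] by (simp add: algebra_simps)

lemma ex_Sigma3:
  assumes "{i, j, k} = {1, 2, 3::nat}"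
  shows "\<exists>\<sigma>\<in>Sigma3. \<sigma> 1 = i \<and> \<sigma> 2 = j \<and> \<sigma> 3 = k"
proof -
  define \<sigma> where "\<sigma> x = (if x = 1 then i else if x = 2 then j else if x = 3 then k else x)" for x :: nat
  have s: "{1..3} = {1, 2, 3::nat}" by auto
  \<comment> \<open>Injectivity comes for free: a map of a finite set onto itself is
    injective.\<close>
  have "\<sigma> ` {1, 2, 3} = {i, j, k}" by (auto simp: \<sigma>_def)
  then have im: "\<sigma> ` {1..3} = {1..3}" unfolding s assms .
  then have "bij_betw \<sigma> {1..3} {1..3}"
    by (simp add: bij_betw_def eq_card_imp_inj_on)
  then have "\<sigma> permutes {1..3}"
    by (rule bij_imp_permutes) (auto simp: \<sigma>_def)
  then show ?thesis
    by (intro bexI[of _ \<sigma>]) (simp_all only: Sigma3_iff, simp_all add: \<sigma>_def)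
qed

lemma monomials3_Sigma3: "monomials 3 = rmon ` Sigma3 \<union> lmon ` Sigma3"
proof -
  have labels: "{\<sigma> 1, \<sigma> 2, \<sigma> 3} = {1, 2, 3}" if "\<sigma> \<in> Sigma3" for \<sigma>
  proof -
    have s: "{1..3} = {1, 2, 3::nat}" by auto
    have "\<sigma> ` {1..3} = {1..3}" using that permutes_image unfolding Sigma3_iff by blast
    then show ?thesis unfolding s by simp
  qed
  have "(\<lambda>\<sigma>. m (\<sigma> 1) (\<sigma> 2) (\<sigma> 3)) ` Sigma3 = {m i j k | i j k. {i, j, k} = {1, 2, 3}}"
    (is "?A = ?B") for m :: "nat \<Rightarrow> nat \<Rightarrow> nat \<Rightarrow> nat mag"
  proof
    show "?A \<subseteq> ?B" using labels by blast
    show "?B \<subseteq> ?A"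
    proof
      fix t assume "t \<in> ?B"
      then obtain i j k where ijk: "{i, j, k} = {1, 2, 3}" "t = m i j k" by blast
      obtain \<sigma> where "\<sigma> \<in> Sigma3" "\<sigma> 1 = i \<and> \<sigma> 2 = j \<and> \<sigma> 3 = k"
        using ex_Sigma3[OF ijk(1)] by (elim bexE)
      then show "t \<in> ?A" unfolding ijk(2) by (intro image_eqI[of _ _ \<sigma>]) simp_all
    qed
  qed
  then show ?thesis
    by (simp only: monomials3 rmon_def[abs_def] lmon_def[abs_def])
qed

text \<open>The action relabels monomials by the inverse of \<sigma>, so coefficients are pulled
  back along \<sigma> itself. This turns statements about \<open>act\<close> into statements about
  single coefficients.\<close>

lemma lookup_act:
  assumes "bij \<sigma>"
  shows "Poly_Mapping.lookup (act \<sigma> f) t = Poly_Mapping.lookup f (map_mag \<sigma> t)"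
proof -
  have "map_mag (pinv \<sigma>) s = t \<longleftrightarrow> s = map_mag \<sigma> t" for s
    using surj_iff[THEN iffD1, OF bij_is_surj[OF assms]] inj_iff[THEN iffD1, OF bij_is_inj[OF assms]]
    by (auto simp: mag.map_comp mag.map_id)
  then show ?thesis
    by (auto simp: act_def lookup_sum lookup_single when_def in_keys_iff)
qed

lemma Gamma3_expand:
  fixes h :: "nat mag \<Rightarrow>\<^sub>0 'k::field"
  assumes "h \<in> Gamma 3"
  shows "h = (\<Sum>\<sigma>\<in>Sigma3. scale (Poly_Mapping.lookup h (rmon \<sigma>)) (basis (rmon \<sigma>))
                        + scale (Poly_Mapping.lookup h (lmon \<sigma>)) (basis (lmon \<sigma>)))"
    (is "h = ?s")
proof (rule poly_mapping_eqI)
  fix t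
  have l: "Poly_Mapping.lookup ?s t = (\<Sum>\<sigma>\<in>Sigma3.
      (if rmon \<sigma> = t then Poly_Mapping.lookup h t else 0)
      + (if lmon \<sigma> = t then Poly_Mapping.lookup h t else 0))"
    unfolding lookup_sum by (rule sum.cong) (auto simp: lookup_add lookup_single when_def)
  consider \<tau> where "\<tau> \<in> Sigma3" "t = rmon \<tau>" | \<tau> where "\<tau> \<in> Sigma3" "t = lmon \<tau>"
    | "t \<notin> monomials 3"
    unfolding monomials3_Sigma3 by blast
  then show "Poly_Mapping.lookup h t = Poly_Mapping.lookup ?s t"
  proof cases
    case 1
    then show ?thesis unfolding l
      by (simp add: rmon_eq_iff rmon_neq_lmon fin3 cong: sum.cong)
  next
    case 2
    then show ?thesis unfolding l
      by (simp add: lmon_eq_iff rmon_neq_lmon fin3 cong: sum.cong)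
  next
    case 3
    then have "Poly_Mapping.lookup h t = 0"
      using assms by (auto simp: Gamma_def in_keys_iff)
    then show ?thesis unfolding l by (simp cong: if_cong)
  qed
qed

lemma subspace_Gamma: "lin.subspace (Gamma n)"
  unfolding lin.subspace_def Gamma_def subset_iff in_keys_iff
  by (auto simp: lookup_add) (metis add.left_neutral)

lemma act_Gamma3: "\<sigma> \<in> Sigma3 \<Longrightarrow> f \<in> Gamma 3 \<Longrightarrow> act \<sigma> f \<in> Gamma 3"
proof -
  assume \<sigma>: "\<sigma> \<in> Sigma3" and f: "f \<in> Gamma 3"
  have "t \<in> monomials 3" if "Poly_Mapping.lookup (act \<sigma> f) t \<noteq> 0" for t
  proof -
    have "map_mag \<sigma> t \<in> monomials 3"
      using that f unfolding lookup_act[OF Sigma3_bij[OF \<sigma>]]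
      by (auto simp: Gamma_def subset_iff in_keys_iff)
    \<comment> \<open>Relabelling a monomial indexed by \<tau> gives the one indexed by
      \<open>pinv \<sigma> \<circ> \<tau>\<close>, so undoing \<sigma> stays among the monomials and
      recovers \<open>t\<close>.\<close>
    then have "map_mag (pinv \<sigma>) (map_mag \<sigma> t) \<in> monomials 3"
      using \<sigma> unfolding monomials3_Sigma3
      by (auto simp: map_rmon map_lmon Sigma3_comp Sigma3_inv)
    then show ?thesis
      using \<sigma> by (simp add: mag.map_comp Sigma3_inv_id mag.map_id)
  qed
  then show ?thesis by (auto simp: Gamma_def in_keys_iff)
qed

section \<open>The bilinear form against monomials\<close>

lemma form_add_right: "form f (g + h) = form f g + form f h"
  and form_scale_right: "form f (scale c g) = c * form f g"
  by (simp_all add: form_def Let_def lookup_add sum_distrib_left algebra_simps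
      flip: sum.distrib)

lemma form_zero_right: "form f 0 = 0"
  by (simp add: form_def)

lemma form_diff_right: "form f (g - h) = form f g - form f h"
  using form_add_right[of f "g - h" h] by simp

lemma form_sum_right: "form f (sum h A) = (\<Sum>x\<in>A. form f (h x))"
  by (induction A rule: infinite_finite_induct) (simp_all add: form_add_right form_zero_right)

lemma form_rmon:
  assumes "\<sigma> \<in> Sigma3"
  shows "form f (basis (rmon \<sigma>)) = of_int (sign \<sigma>) * Poly_Mapping.lookup f (rmon \<sigma>)"
proof -
  have "form f (basis (rmon \<sigma>)) = (\<Sum>\<tau>\<in>Sigma3.
      if \<tau> = \<sigma> then of_int (sign \<sigma>) * Poly_Mapping.lookup f (rmon \<sigma>) else 0)"
    unfolding form_def Let_def rmon_def[symmetric] lmon_def[symmetric]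
    by (rule sum.cong) (use assms in \<open>auto simp: lookup_single when_def rmon_eq_iff rmon_neq_lmon\<close>)
  then show ?thesis using assms by (simp add: fin3)
qed

lemma form_lmon:
  assumes "\<sigma> \<in> Sigma3"
  shows "form f (basis (lmon \<sigma>)) = - of_int (sign \<sigma>) * Poly_Mapping.lookup f (lmon \<sigma>)"
proof -
  have "form f (basis (lmon \<sigma>)) = (\<Sum>\<tau>\<in>Sigma3.
      if \<tau> = \<sigma> then - of_int (sign \<sigma>) * Poly_Mapping.lookup f (lmon \<sigma>) else 0)"
    unfolding form_def Let_def rmon_def[symmetric] lmon_def[symmetric]
    by (rule sum.cong) (use assms in \<open>auto simp: lookup_single when_def lmon_eq_iff rmon_neq_lmon\<close>)
  then show ?thesis using assms by (simp add: fin3)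
qed

text \<open>Linearity of the form in its second argument reduces orthogonality to the relations of
  \<open>G_Ass\<close> to orthogonality to the orbit spanning them.\<close>

lemma dual_relations_span: "dual_relations (lin.span S) = dual_relations S"
proof -
  have "form f g = 0" if "\<forall>g\<in>S. form f g = 0" "g \<in> lin.span S" for f g :: "nat mag \<Rightarrow>\<^sub>0 'a"
    using that(2)
    by (induction rule: lin.span_induct_alt)
      (use that(1) in \<open>simp_all add: form_zero_right form_add_right form_scale_right\<close>)
  then show ?thesis
    unfolding dual_relations_def using lin.span_base by blast
qed

section \<open>Coset sums and the subspace on which they vanish\<close>

definition coset_sum :: "(nat \<Rightarrow> nat) set \<Rightarrow> (nat mag \<Rightarrow>\<^sub>0 'k::field) \<Rightarrow> (nat \<Rightarrow> nat) \<Rightarrow> 'k" where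
  "coset_sum H f \<rho> =
     (\<Sum>g\<in>H. Poly_Mapping.lookup f (rmon (\<rho> \<circ> g)) + Poly_Mapping.lookup f (lmon (\<rho> \<circ> g)))"

definition coset_balanced :: "(nat \<Rightarrow> nat) set \<Rightarrow> (nat mag \<Rightarrow>\<^sub>0 'k::field) set" where
  "coset_balanced H = {f \<in> Gamma 3. \<forall>\<rho>\<in>Sigma3. coset_sum H f \<rho> = 0}"

lemma coset_sum_add: "coset_sum H (f + g) \<rho> = coset_sum H f \<rho> + coset_sum H g \<rho>"
  and coset_sum_scale: "coset_sum H (scale c f) \<rho> = c * coset_sum H f \<rho>"
  and coset_sum_zero: "coset_sum H 0 \<rho> = 0"
  by (simp_all add: coset_sum_def lookup_add sum_distrib_left algebra_simps flip: sum.distrib)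

lemma coset_sum_diff: "coset_sum H (f - g) \<rho> = coset_sum H f \<rho> - coset_sum H g \<rho>"
  using coset_sum_add[of H "f - g" g \<rho>] by simp

lemma coset_sum_act:
  "\<sigma> \<in> Sigma3 \<Longrightarrow> coset_sum H (act \<sigma> f) \<rho> = coset_sum H f (\<sigma> \<circ> \<rho>)"
  by (simp add: coset_sum_def lookup_act Sigma3_bij map_rmon map_lmon o_assoc)

text \<open>Acting by \<sigma> replaces the sum over \<open>\<rho>H\<close> by the sum over
  \<open>\<sigma>\<rho>H\<close>, so a condition imposed for all \<rho> is preserved.\<close>

lemma invariant_coset_balanced: "invariant (coset_balanced H)"
  using subspace_Gamma[of 3]
  unfolding invariant_def coset_balanced_def lin.subspace_def
  by (auto simp: coset_sum_add coset_sum_scale coset_sum_zero coset_sum_act act_Gamma3 Sigma3_comp)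

text \<open>The subgroup laws are phrased with composition and inverse of functions, the operations
  by which \<open>act\<close> relabels monomials.\<close>

locale Sigma3_subgroup =
  fixes H :: "(nat \<Rightarrow> nat) set"
  assumes H_Sigma3: "\<sigma> \<in> H \<Longrightarrow> \<sigma> \<in> Sigma3"
    and H_id: "id \<in> H"
    and H_comp: "\<sigma> \<in> H \<Longrightarrow> \<tau> \<in> H \<Longrightarrow> \<sigma> \<circ> \<tau> \<in> H"
    and H_inv: "\<sigma> \<in> H \<Longrightarrow> pinv \<sigma> \<in> H"
begin

lemma finite_H: "finite H"
  using H_Sigma3 fin3 by (meson finite_subset subsetI)

text \<open>A single g solves \<open>\<rho> \<circ> g = \<sigma>\<close>, so the coset sum of a
  monomial is the indicator of \<sigma> lying in \<open>\<rho>H\<close>.\<close>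

lemma coset_sum_rmon:
  assumes "\<rho> \<in> Sigma3" "\<sigma> \<in> Sigma3"
  shows "coset_sum H (basis (rmon \<sigma>)) \<rho> = (if pinv \<rho> \<circ> \<sigma> \<in> H then 1 else (0::'k::field))"
proof -
  have "\<rho> \<circ> g = \<sigma> \<longleftrightarrow> g = pinv \<rho> \<circ> \<sigma>" for g
    using assms Sigma3_inv_comp Sigma3_comp_inv by metis
  then have "coset_sum H (basis (rmon \<sigma>)) \<rho>
      = (\<Sum>g\<in>H. if g = pinv \<rho> \<circ> \<sigma> then 1 else (0::'k))"
    unfolding coset_sum_def
    by (intro sum.cong refl) (use assms H_Sigma3 in
      \<open>simp add: lookup_single when_def rmon_neq_lmon rmon_eq_iff Sigma3_comp eq_commute[of \<sigma>]\<close>)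
  then show ?thesis by (simp add: finite_H)
qed

lemma coset_sum_lmon:
  assumes "\<rho> \<in> Sigma3" "\<sigma> \<in> Sigma3"
  shows "coset_sum H (basis (lmon \<sigma>)) \<rho> = (if pinv \<rho> \<circ> \<sigma> \<in> H then 1 else (0::'k::field))"
proof -
  have "\<rho> \<circ> g = \<sigma> \<longleftrightarrow> g = pinv \<rho> \<circ> \<sigma>" for g
    using assms Sigma3_inv_comp Sigma3_comp_inv by metis
  then have "coset_sum H (basis (lmon \<sigma>)) \<rho>
      = (\<Sum>g\<in>H. if g = pinv \<rho> \<circ> \<sigma> then 1 else (0::'k))"
    unfolding coset_sum_def
    by (intro sum.cong refl) (use assms H_Sigma3 in
      \<open>simp add: lookup_single when_def rmon_neq_lmon lmon_eq_iff Sigma3_comp eq_commute[of \<sigma>]\<close>)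
  then show ?thesis by (simp add: finite_H)
qed

lemma H_coset:
  assumes "\<rho> \<in> Sigma3" "\<sigma> \<in> H"
  shows "pinv \<rho> \<circ> \<sigma> \<in> H \<longleftrightarrow> pinv \<rho> \<in> H"
proof -
  have "pinv \<rho> \<circ> \<sigma> \<circ> pinv \<sigma> = pinv \<rho>"
    using assms by (simp add: comp_assoc Sigma3_inv_id H_Sigma3)
  then show ?thesis using assms H_comp H_inv by metis
qed

text \<open>By \<open>H_coset\<close>, all monomials labelled by elements of \<open>H\<close>, with
  either bracketing, have the same coset sums: 1 if \<open>\<rho>H = H\<close> and 0 otherwise.
  These cancel in a difference.\<close>

lemma coset_balanced_differences:
  assumes "s \<in> rmon ` H \<union> lmon ` H" "t \<in> rmon ` H \<union> lmon ` H"
  shows "basis s - basis t \<in> (coset_balanced H :: (nat mag \<Rightarrow>\<^sub>0 'k::field) set)"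
proof -
  have "basis u \<in> (Gamma 3 :: (nat mag \<Rightarrow>\<^sub>0 'k) set) \<and>
      (\<forall>\<rho>\<in>Sigma3. coset_sum H (basis u) \<rho> = (if pinv \<rho> \<in> H then 1 else (0::'k)))"
    if "u \<in> rmon ` H \<union> lmon ` H" for u
    using that H_Sigma3
    by (auto simp: Gamma_def monomials3_Sigma3 coset_sum_rmon coset_sum_lmon H_coset)
  from this[OF assms(1)] this[OF assms(2)] show ?thesis
    by (simp add: coset_balanced_def coset_sum_diff lin.subspace_diff subspace_Gamma)
qed

text \<open>Translates of the two given kinds of differences move every monomial, modulo
  \<open>W\<close>, to the left-bracketed monomial of a representative of its coset. What remains
  has the coset sums as coefficients, hence vanishes for balanced vectors.\<close>

lemma coset_balanced_least:
  fixes W :: "(nat mag \<Rightarrow>\<^sub>0 'k::field) set"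
  assumes W: "invariant W"
    and ll: "\<And>g. g \<in> H \<Longrightarrow> basis (lmon id) - basis (lmon g) \<in> W"
    and rl: "basis (rmon id) - basis (lmon id) \<in> W"
  shows "coset_balanced H \<subseteq> W"
proof
  fix h :: "nat mag \<Rightarrow>\<^sub>0 'k" assume h: "h \<in> coset_balanced H"
  have sub: "lin.subspace W" and actW: "\<And>\<sigma> f. \<sigma> \<in> Sigma3 \<Longrightarrow> f \<in> W \<Longrightarrow> act \<sigma> f \<in> W"
    using W by (auto simp: invariant_def)
  \<comment> \<open>Acting by \<open>pinv \<sigma>\<close> multiplies labels by \<sigma> on the
    left, which carries the given differences to an arbitrary coset.\<close>
  have ll': "basis (lmon \<sigma>) - basis (lmon (\<sigma> \<circ> g)) \<in> W" if "\<sigma> \<in> Sigma3" "g \<in> H" for \<sigma> g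
    using actW[OF Sigma3_inv[OF that(1)] ll[OF that(2)]] that
    by (simp add: act_diff act_lmon Sigma3_inv_inv)
  have rl': "basis (rmon \<sigma>) - basis (lmon \<sigma>) \<in> W" if "\<sigma> \<in> Sigma3" for \<sigma>
    using actW[OF Sigma3_inv[OF that(1)] rl] that
    by (simp add: act_diff act_lmon act_rmon Sigma3_inv_inv)
  \<comment> \<open>The choice is made from the coset as a set, so elements of the same coset
    receive the same representative.\<close>
  define rep where "rep \<sigma> = (SOME \<tau>. \<tau> \<in> (\<lambda>g. \<sigma> \<circ> g) ` H)" for \<sigma> :: "nat \<Rightarrow> nat"
  have rep: "\<exists>g\<in>H. rep \<sigma> = \<sigma> \<circ> g" for \<sigma>
    using someI[of "\<lambda>\<tau>. \<tau> \<in> (\<lambda>g. \<sigma> \<circ> g) ` H" "\<sigma> \<circ> id"] H_id unfolding rep_def image_iff by blast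
  have coset: "(\<lambda>k. (\<sigma> \<circ> g) \<circ> k) ` H = (\<lambda>k. \<sigma> \<circ> k) ` H" if "g \<in> H" for \<sigma> g
  proof -
    have "\<sigma> \<circ> g \<circ> (pinv g \<circ> k) = \<sigma> \<circ> k" for k :: "nat \<Rightarrow> nat"
      using Sigma3_comp_inv[OF H_Sigma3[OF that], of k] by (simp add: comp_assoc)
    then show ?thesis
      using that H_comp H_inv by (auto simp: comp_assoc) (metis comp_assoc imageI)
  qed
  have rep_eq: "{\<tau> \<in> Sigma3. rep \<tau> = rep \<sigma>} = (\<lambda>g. \<sigma> \<circ> g) ` H" if \<sigma>: "\<sigma> \<in> Sigma3" for \<sigma>
  proof (intro equalityI subsetI)
    fix \<tau> assume \<tau>: "\<tau> \<in> {\<tau> \<in> Sigma3. rep \<tau> = rep \<sigma>}"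
    obtain g k where "g \<in> H" "k \<in> H" "\<tau> \<circ> g = \<sigma> \<circ> k" using rep \<tau> by (metis (mono_tags, lifting) mem_Collect_eq)
    then have "(\<lambda>g. \<tau> \<circ> g) ` H = (\<lambda>g. \<sigma> \<circ> g) ` H" by (metis coset)
    then show "\<tau> \<in> (\<lambda>g. \<sigma> \<circ> g) ` H" using H_id by (metis comp_id imageI)
  next
    fix \<tau> assume "\<tau> \<in> (\<lambda>g. \<sigma> \<circ> g) ` H"
    then obtain g where g: "g \<in> H" "\<tau> = \<sigma> \<circ> g" by blast
    then have "rep \<tau> = rep \<sigma>" unfolding rep_def by (simp add: coset)
    then show "\<tau> \<in> {\<tau> \<in> Sigma3. rep \<tau> = rep \<sigma>}" using g \<sigma> by (simp add: Sigma3_comp H_Sigma3)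
  qed
  \<comment> \<open>The coefficient of \<open>lmon \<sigma>\<close> once
    \<open>rmon \<sigma>\<close> has been traded for it.\<close>
  define c where "c \<sigma> = Poly_Mapping.lookup h (rmon \<sigma>) + Poly_Mapping.lookup h (lmon \<sigma>)" for \<sigma>
  have zero: "(\<Sum>\<tau> | \<tau> \<in> Sigma3 \<and> rep \<tau> = rep \<sigma>. c \<tau>) = 0" if "\<sigma> \<in> Sigma3" for \<sigma>
  proof -
    have "inj_on (\<lambda>g. \<sigma> \<circ> g) H"
      by (rule inj_onI) (metis that Sigma3_inv_comp)
    then have "(\<Sum>\<tau> | \<tau> \<in> Sigma3 \<and> rep \<tau> = rep \<sigma>. c \<tau>) = coset_sum H h \<sigma>"
      unfolding rep_eq[OF that] coset_sum_def c_def by (simp add: sum.reindex)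
    then show ?thesis using h that by (simp add: coset_balanced_def)
  qed
  \<comment> \<open>Terms are grouped by representative; the fibres of \<open>rep\<close> are the
    left cosets, so \<open>zero\<close> kills each group.\<close>
  have "(\<Sum>\<sigma>\<in>Sigma3. scale (c \<sigma>) (basis (lmon (rep \<sigma>)) :: nat mag \<Rightarrow>\<^sub>0 'k))
      = (\<Sum>y\<in>rep ` Sigma3. \<Sum>\<sigma> | \<sigma> \<in> Sigma3 \<and> rep \<sigma> = y. scale (c \<sigma>) (basis (lmon (rep \<sigma>))))"
    by (rule sum.image_gen[OF fin3])
  also have "\<dots> = (\<Sum>y\<in>rep ` Sigma3. scale (\<Sum>\<sigma> | \<sigma> \<in> Sigma3 \<and> rep \<sigma> = y. c \<sigma>) (basis (lmon y)))"
    by (simp add: lin.scale_sum_left)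
  also have "\<dots> = 0"
    using zero by (intro sum.neutral) auto
  finally have reps: "(\<Sum>\<sigma>\<in>Sigma3. scale (c \<sigma>) (basis (lmon (rep \<sigma>)) :: nat mag \<Rightarrow>\<^sub>0 'k)) = 0" .
  have "h = (\<Sum>\<sigma>\<in>Sigma3. scale (Poly_Mapping.lookup h (rmon \<sigma>)) (basis (rmon \<sigma>))
                        + scale (Poly_Mapping.lookup h (lmon \<sigma>)) (basis (lmon \<sigma>)))"
    using h by (intro Gamma3_expand) (simp add: coset_balanced_def)
  \<comment> \<open>Each term is telescoped along \<open>rmon \<sigma>\<close>,
    \<open>lmon \<sigma>\<close>, \<open>lmon (rep \<sigma>)\<close>.\<close>
  also have "\<dots> = (\<Sum>\<sigma>\<in>Sigma3.
        (scale (Poly_Mapping.lookup h (rmon \<sigma>)) (basis (rmon \<sigma>) - basis (lmon \<sigma>))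
         + scale (c \<sigma>) (basis (lmon \<sigma>) - basis (lmon (rep \<sigma>))))
        + scale (c \<sigma>) (basis (lmon (rep \<sigma>))))"
    by (intro sum.cong refl)
      (simp add: c_def lin.scale_right_diff_distrib lin.scale_left_distrib)
  also have "\<dots> = (\<Sum>\<sigma>\<in>Sigma3.
        scale (Poly_Mapping.lookup h (rmon \<sigma>)) (basis (rmon \<sigma>) - basis (lmon \<sigma>))
         + scale (c \<sigma>) (basis (lmon \<sigma>) - basis (lmon (rep \<sigma>))))"
    by (simp add: sum.distrib reps)
  also have "\<dots> \<in> W"
  proof (intro lin.subspace_sum[OF sub] lin.subspace_add[OF sub] lin.subspace_scale[OF sub])
    fix \<sigma> assume "\<sigma> \<in> Sigma3"
    then show "basis (rmon \<sigma>) - basis (lmon \<sigma>) \<in> W"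
      and "basis (lmon \<sigma>) - basis (lmon (rep \<sigma>)) \<in> W"
      using rl' ll' rep by (blast, metis)
  qed
  finally show "h \<in> W" .
qed

end

section \<open>The subgroups \<open>G i\<close> and the orbit of \<open>X_G i\<close>\<close>

lemma G_Sigma3_subgroup: "Sigma3_subgroup (G i)"
proof -
  have gen: "subgroup (generate (sym_group 3) {p}) (sym_group 3)" if "p \<in> Sigma3" for p
    using that by (intro group.generate_is_subgroup sym_group_is_group) auto
  have "transpose a b \<in> Sigma3" if "{a, b} \<subseteq> {1..3}" for a b
    using that permutes_swap_id[of a "{1..3}" b] unfolding Sigma3_iff by auto
  moreover have "cycle_of_list [1, 2, 3] \<in> Sigma3"
  proof -
    have "{1..3} = set [1, 2, 3::nat]" by auto
    then show ?thesis unfolding Sigma3_iff by (metis cycle_permutes)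
  qed
  moreover have "subgroup {id} (sym_group 3)"
    using group.triv_subgroup[OF sym_group_is_group, of 3] by (simp add: sym_group_def)
  moreover have "subgroup Sigma3 (sym_group 3)"
    by (rule group.subgroup_self[OF sym_group_is_group])
  ultimately have s: "subgroup (G i) (sym_group 3)"
    using gen by (simp add: G_def)
  show ?thesis
  proof
    fix \<sigma> assume \<sigma>: "\<sigma> \<in> G i"
    then show \<sigma>3: "\<sigma> \<in> Sigma3" using G_subset by blast
    \<comment> \<open>Closure under inverses is known for the abstract group inverse, which has to
      be matched with the inverse function.\<close>
    then have "m_inv (sym_group 3) \<sigma> = pinv \<sigma>"
      using Sigma3_inv[OF \<sigma>3]
      by (intro group.inv_equality[OF sym_group_is_group]) (simp_all add: Sigma3_inv_id sym_group_def)
    then show "pinv \<sigma> \<in> G i" using subgroup.m_inv_closed[OF s \<sigma>] by simp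
    show "\<sigma> \<circ> \<tau> \<in> G i" if "\<tau> \<in> G i" for \<tau>
      using subgroup.m_closed[OF s \<sigma> that] by (simp add: sym_group_def)
  next
    show "id \<in> G i" using subgroup.one_closed[OF s] by (simp add: sym_group_def)
  qed
qed

text \<open>The action inverts the summation index; since g and its inverse have the same sign and
  both lie in \<open>G i\<close>, the sum can be reindexed to run over the left coset of
  \<rho>.\<close>

lemma act_X_G:
  assumes "\<rho> \<in> Sigma3"
  shows "act (pinv \<rho>) (X_G i) = (\<Sum>g\<in>G i. scale (of_int (sign g))
           (basis (rmon (\<rho> \<circ> g)) - basis (lmon (\<rho> \<circ> g)) :: nat mag \<Rightarrow>\<^sub>0 'k::field))"
proof -
  interpret Sigma3_subgroup "G i" by (rule G_Sigma3_subgroup)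
  have "act (pinv \<rho>) (X_G i :: nat mag \<Rightarrow>\<^sub>0 'k) = (\<Sum>g\<in>G i. scale (of_int (sign g))
          (basis (rmon (\<rho> \<circ> pinv g)) - basis (lmon (\<rho> \<circ> pinv g))))"
    unfolding X_G_def X_assoc_def mon_id
    by (simp add: act_sum act_scale act_diff act_rmon act_lmon Sigma3_inv_inv assms)
  also have "\<dots> = (\<Sum>g\<in>G i. scale (of_int (sign g))
           (basis (rmon (\<rho> \<circ> g)) - basis (lmon (\<rho> \<circ> g))))"
    by (rule sum.reindex_bij_witness[where i = pinv and j = pinv])
      (auto simp: H_Sigma3 Sigma3_inv_inv H_inv sign_inverse Sigma3_permutation)
  finally show ?thesis .
qed

text \<open>The sign of \<open>\<rho> \<circ> g\<close> in the form times the sign of g in the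
  vector is the sign of \<rho>. The minus sign of the form on left-bracketed monomials cancels the
  one in \<open>X_assoc\<close>.\<close>

lemma form_act_X_G:
  assumes "\<rho> \<in> Sigma3"
  shows "form f (act (pinv \<rho>) (X_G i)) = of_int (sign \<rho>) * coset_sum (G i) f \<rho>"
proof -
  interpret Sigma3_subgroup "G i" by (rule G_Sigma3_subgroup)
  have "of_int (sign g) * (of_int (sign (\<rho> \<circ> g)) * x) = of_int (sign \<rho>) * (x::'a)"
    if "g \<in> G i" for g x
  proof -
    have "sign (\<rho> \<circ> g) * sign g = sign \<rho>"
      using that assms by (simp add: sign_compose Sigma3_permutation H_Sigma3)
    then have "of_int (sign \<rho>) = of_int (sign (\<rho> \<circ> g)) * (of_int (sign g) :: 'a)"
      by (metis of_int_mult)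
    then show ?thesis by simp
  qed
  then show ?thesis
    unfolding act_X_G[OF assms] coset_sum_def form_sum_right sum_distrib_left
    by (intro sum.cong refl)
      (simp add: assms form_scale_right form_diff_right form_rmon form_lmon Sigma3_comp H_Sigma3
        flip: distrib_left)
qed

section \<open>Both modules of relations equal \<open>coset_balanced (G i)\<close>\<close>

lemma dual_G_Ass_relations: "dual_relations (G_Ass_relations i) = coset_balanced (G i)"
proof -
  have "(\<forall>\<sigma>\<in>Sigma3. form f (act \<sigma> (X_G i)) = 0) \<longleftrightarrow> (\<forall>\<rho>\<in>Sigma3. coset_sum (G i) f \<rho> = 0)"
    for f :: "nat mag \<Rightarrow>\<^sub>0 'a"
  proof -
    have "(\<forall>\<sigma>\<in>Sigma3. form f (act \<sigma> (X_G i)) = 0)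
        \<longleftrightarrow> (\<forall>\<rho>\<in>Sigma3. form f (act (pinv \<rho>) (X_G i)) = 0)"
      using Sigma3_inv Sigma3_inv_inv by metis
    also have "\<dots> \<longleftrightarrow> (\<forall>\<rho>\<in>Sigma3. coset_sum (G i) f \<rho> = 0)"
      \<comment> \<open>The factor \<open>sign \<rho>\<close> is 1 or -1, hence nonzero in every
        field, characteristic 2 included.\<close>
      by (auto simp: form_act_X_G sign_def)
    finally show ?thesis .
  qed
  then show ?thesis
    unfolding G_Ass_relations_def dual_relations_span
    by (auto simp: dual_relations_def coset_balanced_def)
qed

lemma lookup_V_G:
  "Poly_Mapping.lookup (V_G i :: 'k::field group_alg) \<sigma> = (if \<sigma> \<in> G i then of_int (sign \<sigma>) else 0)"
  using finite_subset[OF G_subset fin3]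
  by (auto simp: V_G_def lookup_sum lookup_single when_def if_distrib cong: if_cong)

text \<open>Generators with an index outside \<open>G i\<close> vanish, and the others are
  differences of monomials labelled by \<open>G i\<close>, up to sign. Conversely, these include the
  differences required by \<open>coset_balanced_least\<close>.\<close>

lemma tilde_V_G_relations:
  "tilde_relations (V_G i) (V_G i) = (coset_balanced (G i) :: (nat mag \<Rightarrow>\<^sub>0 'k::field) set)"
proof -
  interpret Sigma3_subgroup "G i" by (rule G_Sigma3_subgroup)
  define a :: "(nat \<Rightarrow> nat) \<Rightarrow> 'k" where "a = Poly_Mapping.lookup (V_G i)"
  define S where "S =
       {scale (a \<sigma> * a \<tau>) (basis (lmon (pinv \<sigma>)) - basis (lmon (pinv \<tau>))) | \<sigma> \<tau>. \<sigma> \<in> Sigma3 \<and> \<tau> \<in> Sigma3} \<union>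
       {scale (a \<sigma> * a \<tau>) (basis (rmon (pinv \<sigma>)) - basis (rmon (pinv \<tau>))) | \<sigma> \<tau>. \<sigma> \<in> Sigma3 \<and> \<tau> \<in> Sigma3} \<union>
       {scale (a \<sigma> * a \<tau>) (basis (lmon (pinv \<sigma>)) - basis (rmon (pinv \<tau>))) | \<sigma> \<tau>. \<sigma> \<in> Sigma3 \<and> \<tau> \<in> Sigma3}"
  have tilde: "tilde_relations (V_G i) (V_G i) = invariant hull S"
    by (simp only: tilde_relations_def S_def a_def Let_def mon_id act_lmon act_rmon comp_id)
  have aG: "a \<sigma> = (if \<sigma> \<in> G i then of_int (sign \<sigma>) else 0)" for \<sigma>
    unfolding a_def by (rule lookup_V_G)
  have scaled: "scale (a \<sigma> * a \<tau>) f \<in> coset_balanced (G i)"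
    if "\<sigma> \<in> G i \<Longrightarrow> \<tau> \<in> G i \<Longrightarrow> f \<in> coset_balanced (G i)" for \<sigma> \<tau> and f :: "nat mag \<Rightarrow>\<^sub>0 'k"
  proof -
    have "lin.subspace (coset_balanced (G i) :: (nat mag \<Rightarrow>\<^sub>0 'k) set)"
      using invariant_coset_balanced by (auto simp: invariant_def)
    then show ?thesis
      using that by (cases "\<sigma> \<in> G i \<and> \<tau> \<in> G i") (auto simp: aG lin.subspace_scale lin.subspace_0)
  qed
  show ?thesis
    unfolding tilde
  proof (rule hull_unique)
    show "S \<subseteq> coset_balanced (G i)"
      unfolding S_def by (auto intro!: scaled coset_balanced_differences H_inv)
    show "invariant (coset_balanced (G i) :: (nat mag \<Rightarrow>\<^sub>0 'k) set)"
      by (rule invariant_coset_balanced)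
  next
    fix W assume W: "S \<subseteq> W" "invariant W"
    then have sub: "lin.subspace W" by (simp add: invariant_def)
    \<comment> \<open>On \<open>G i\<close> the coefficients are 1 or -1, so their product can be
      divided out.\<close>
    have unscale: "f \<in> W" if "scale (a \<sigma> * a \<tau>) f \<in> W" "\<sigma> \<in> G i" "\<tau> \<in> G i" for \<sigma> \<tau> f
    proof -
      have "a \<sigma> * a \<tau> \<noteq> 0" using that by (simp add: aG sign_def)
      then have "f = scale (inverse (a \<sigma> * a \<tau>)) (scale (a \<sigma> * a \<tau>) f)"
        by (simp add: field_simps)
      then show ?thesis using lin.subspace_scale[OF sub that(1)] by metis
    qed
    show "coset_balanced (G i) \<subseteq> W"
    proof (rule coset_balanced_least[OF W(2)])
      fix g assume g: "g \<in> G i"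
      \<comment> \<open>The index is \<open>pinv g\<close> because the action inverts it, yielding
        the monomial \<open>lmon g\<close>.\<close>
      have "scale (a id * a (pinv g)) (basis (lmon (pinv id)) - basis (lmon (pinv (pinv g)))) \<in> S"
        using g Sigma3_id Sigma3_inv H_Sigma3 unfolding S_def by blast
      then have "scale (a id * a (pinv g)) (basis (lmon id) - basis (lmon g)) \<in> W"
        using W(1) g by (auto simp: Sigma3_inv_inv H_Sigma3)
      then show "basis (lmon id) - basis (lmon g) \<in> W"
        by (rule unscale) (use g H_id H_inv in auto)
    next
      have "scale (a id * a id) (basis (lmon (pinv id)) - basis (rmon (pinv id))) \<in> S"
        using Sigma3_id unfolding S_def by blast
      then have "scale (a id * a id) (basis (lmon id) - basis (rmon id)) \<in> W"
        using W(1) by auto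
      then have "basis (lmon id) - basis (rmon id) \<in> W"
        by (rule unscale) (rule H_id)+
      then show "basis (rmon id) - basis (lmon id) \<in> W"
        using lin.subspace_neg[OF sub] by fastforce
    qed
  qed
qed

theorem proposition8:
  fixes i :: nat
  assumes "i \<in> {1..6}"
  shows "dual_relations (G_Ass_relations i :: (nat mag \<Rightarrow>\<^sub>0 'k::field) set)
           = tilde_relations (V_G i) (V_G i)
       \<and> (G_Ass_dual i :: ('k, (nat mag \<Rightarrow>\<^sub>0 'k) set) operad) = G_Ass_tilde i"
  by (simp add: G_Ass_dual_def G_Ass_tilde_def dual_G_Ass_relations tilde_V_G_relations)

end
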